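(* Let $(X,\to,0,1)$ be an implicative-orthomodular algebra. The following hold for all $x,y,z\in X$: (1) $x\Cap (y\Cup x)=x$ and $x\Cup (y\Cap x)=x$. If moreover $x\le_Q y$, then: (2) $y\Cup x=y$ and $y^*\le_Q x^*$; (3) $y\to z\le_Q x\to z$ and $z\to x\le_Q z\to y$; (4) $x\Cap z\le_Q y\Cap z$ and $x\Cup z\le_Q y\Cup z$; (5) $(z\to y)\Cup (z\to x)=z\to y$.
   Context: A BE algebra is an algebra $(X,\to,1)$ of type $(2,0)$ such that for all $x,y,z\in X$: $x\to x=1$; $x\to 1=1$; $1\to x=x$; $x\to(y\to z)=y\to(x\to z)$. Put $x\le y$ iff $x\to y=1$. It is bounded if there is $0\in X$ with $0\le x$ for all $x\in X$; then $x^*:=x\to 0$. It is involutive if it is bounded and $x^{**}=x$ for all $x$. In an involutive BE algebra $(X,\to,0,1)$ define $x\Cup y:=(x\to y)\to y$, $x\Cap y:=((x^*\to y^* )\to y^* )^*$, and $x\le_Q y$ iff $x=x\Cap y$. An implicative-orthomodular algebra is an involutive BE algebra satisfying $x\Cap(y\to x)=x$ for all $x,y\in X$. *)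

theory Defs
  imports "HOL-Algebra.Congruence"
begin

record 'a be_struct = "'a partial_object" +
  imp :: "'a \<Rightarrow> 'a \<Rightarrow> 'a" (infixr "\<leadsto>\<index>" 75)
  one :: 'a ("\<one>\<index>")

record 'a bounded_be_struct = "'a be_struct" +
  zero :: 'a ("\<zero>\<index>")

definition be_le :: "('a, 'b) be_struct_scheme \<Rightarrow> 'a \<Rightarrow> 'a \<Rightarrow> bool" (infix "\<preceq>\<index>" 50)
  where "x \<preceq>\<^bsub>X\<^esub> y \<longleftrightarrow> x \<leadsto>\<^bsub>X\<^esub> y = \<one>\<^bsub>X\<^esub>"

definition be_cup :: "('a, 'b) be_struct_scheme \<Rightarrow> 'a \<Rightarrow> 'a \<Rightarrow> 'a" (infixl "\<Cup>\<index>" 70)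
  where "x \<Cup>\<^bsub>X\<^esub> y = (x \<leadsto>\<^bsub>X\<^esub> y) \<leadsto>\<^bsub>X\<^esub> y"

definition be_neg :: "('a, 'b) bounded_be_struct_scheme \<Rightarrow> 'a \<Rightarrow> 'a" ("_\<^sup>\<star>\<index>" [1000] 999)
  where "x\<^sup>\<star>\<^bsub>X\<^esub> = x \<leadsto>\<^bsub>X\<^esub> \<zero>\<^bsub>X\<^esub>"

definition be_cap :: "('a, 'b) bounded_be_struct_scheme \<Rightarrow> 'a \<Rightarrow> 'a \<Rightarrow> 'a" (infixl "\<Cap>\<index>" 70)
  where "x \<Cap>\<^bsub>X\<^esub> y = ((x\<^sup>\<star>\<^bsub>X\<^esub> \<leadsto>\<^bsub>X\<^esub> y\<^sup>\<star>\<^bsub>X\<^esub>) \<leadsto>\<^bsub>X\<^esub> y\<^sup>\<star>\<^bsub>X\<^esub>)\<^sup>\<star>\<^bsub>X\<^esub>"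

definition be_leQ :: "('a, 'b) bounded_be_struct_scheme \<Rightarrow> 'a \<Rightarrow> 'a \<Rightarrow> bool" (infix "\<preceq>\<^sub>Q\<index>" 50)
  where "x \<preceq>\<^sub>Q\<^bsub>X\<^esub> y \<longleftrightarrow> x = x \<Cap>\<^bsub>X\<^esub> y"

locale be_algebra =
  fixes X :: "('a, 'b) be_struct_scheme" (structure)
  assumes imp_closed: "\<lbrakk>x \<in> carrier X; y \<in> carrier X\<rbrakk> \<Longrightarrow> x \<leadsto> y \<in> carrier X"
    and one_closed: "\<one> \<in> carrier X"
    and imp_refl: "x \<in> carrier X \<Longrightarrow> x \<leadsto> x = \<one>"
    and imp_one: "x \<in> carrier X \<Longrightarrow> x \<leadsto> \<one> = \<one>"
    and one_imp: "x \<in> carrier X \<Longrightarrow> \<one> \<leadsto> x = x"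
    and imp_exchange: "\<lbrakk>x \<in> carrier X; y \<in> carrier X; z \<in> carrier X\<rbrakk>
      \<Longrightarrow> x \<leadsto> (y \<leadsto> z) = y \<leadsto> (x \<leadsto> z)"

text \<open>The relation \<open>\<preceq>\<close> of a BE algebra need not be antisymmetric, so a least element need not
  be unique; the bottom element is therefore a component of the structure.\<close>

locale bounded_be_algebra = be_algebra X
  for X :: "('a, 'b) bounded_be_struct_scheme" (structure) +
  assumes zero_closed: "\<zero> \<in> carrier X"
    and zero_le: "x \<in> carrier X \<Longrightarrow> \<zero> \<preceq> x"

locale involutive_be_algebra = bounded_be_algebra +
  assumes involutive: "x \<in> carrier X \<Longrightarrow> (x\<^sup>\<star>)\<^sup>\<star> = x"

locale implicative_orthomodular_algebra = involutive_be_algebra +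
  assumes cap_imp: "\<lbrakk>x \<in> carrier X; y \<in> carrier X\<rbrakk> \<Longrightarrow> x \<Cap> (y \<leadsto> x) = x"

end

theory Submission
  imports Defs
begin

text \<open>
  The whole proposition rests on one observation: in an implicative-orthomodular algebra,
  \<open>x \<preceq>\<^sub>Q y\<close> holds exactly if \<open>y\<close> is an implication with conclusion \<open>x\<close>, that is,
  \<open>y = d \<leadsto> x\<close> for some \<open>d\<close> (lemma \<open>leQ_iff_eq_imp\<close>).

  The orthomodular axiom is precisely the statement that \<open>x \<preceq>\<^sub>Q d \<leadsto> x\<close>. For the converse,
  the contraposition law \<open>x \<leadsto> y = y\<^sup>\<star> \<leadsto> x\<^sup>\<star>\<close> rewrites \<open>x = x \<Cap> y\<close> as
  \<open>x\<^sup>\<star> = (y \<leadsto> x) \<leadsto> y\<^sup>\<star>\<close>. This presents \<open>x\<^sup>\<star>\<close> as an implication with conclusion \<open>y\<^sup>\<star>\<close>, so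
  the axiom gives \<open>y\<^sup>\<star> \<preceq>\<^sub>Q x\<^sup>\<star>\<close> (lemma \<open>leQ_neg\<close>); the same rewriting of this second relation
  presents \<open>y\<close> as an implication with conclusion \<open>x\<close>.

  Given the characterization, the exchange law shows that \<open>z \<leadsto> _\<close> is monotone, since
  \<open>z \<leadsto> (d \<leadsto> x) = d \<leadsto> (z \<leadsto> x)\<close>, and contraposition turns this into antitonicity of
  \<open>_ \<leadsto> z\<close>. Two antitone steps make \<open>_ \<Cup> z\<close> monotone, and De Morgan duality transfers this
  to \<open>_ \<Cap> z\<close>. The identity \<open>x \<Cap> (y \<Cup> x) = x\<close> is the relation \<open>x \<preceq>\<^sub>Q y \<Cup> x\<close>, an instance
  of the axiom. The identities with outermost \<open>\<Cup>\<close> come from \<open>y \<Cap> x \<preceq>\<^sub>Q x\<close> and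
  \<open>z \<leadsto> x \<preceq>\<^sub>Q z \<leadsto> y\<close>, because \<open>y \<Cup> x = y\<close> is the De Morgan dual of \<open>y\<^sup>\<star> \<preceq>\<^sub>Q x\<^sup>\<star>\<close>, hence a
  consequence of \<open>x \<preceq>\<^sub>Q y\<close>.
\<close>

context involutive_be_algebra
begin

lemma neg_closed [simp, intro]: "x \<in> carrier X \<Longrightarrow> x\<^sup>\<star> \<in> carrier X"
  by (simp add: be_neg_def imp_closed zero_closed)

lemma cup_closed [simp, intro]: "\<lbrakk>x \<in> carrier X; y \<in> carrier X\<rbrakk> \<Longrightarrow> x \<Cup> y \<in> carrier X"
  by (simp add: be_cup_def imp_closed)

lemma cap_eq_neg_cup: "x \<Cap> y = (x\<^sup>\<star> \<Cup> y\<^sup>\<star>)\<^sup>\<star>"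
  by (simp add: be_cap_def be_cup_def)

lemma cap_closed [simp, intro]: "\<lbrakk>x \<in> carrier X; y \<in> carrier X\<rbrakk> \<Longrightarrow> x \<Cap> y \<in> carrier X"
  by (simp add: cap_eq_neg_cup)

lemma eq_neg_iff:
  assumes "x \<in> carrier X" "y \<in> carrier X"
  shows "x = y\<^sup>\<star> \<longleftrightarrow> x\<^sup>\<star> = y"
  using involutive[OF assms(1)] involutive[OF assms(2)] by metis

text \<open>With \<open>y = y\<^sup>\<star> \<leadsto> \<zero>\<close>, contraposition is an instance of the exchange law.\<close>

lemma imp_contrapos:
  assumes x: "x \<in> carrier X" and y: "y \<in> carrier X"
  shows "y\<^sup>\<star> \<leadsto> x\<^sup>\<star> = x \<leadsto> y"
proof -
  have "y\<^sup>\<star> \<leadsto> (x \<leadsto> \<zero>) = x \<leadsto> (y\<^sup>\<star> \<leadsto> \<zero>)"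
    using x y by (intro imp_exchange) (auto simp: zero_closed)
  then show ?thesis
    using involutive[OF y] by (simp add: be_neg_def)
qed

text \<open>This form of \<open>\<preceq>\<^sub>Q\<close> is the one to which the orthomodular axiom can be applied: the
  equation presents \<open>x\<^sup>\<star>\<close> as an implication with conclusion \<open>y\<^sup>\<star>\<close>.\<close>

lemma leQ_iff_neg_eq:
  assumes x: "x \<in> carrier X" and y: "y \<in> carrier X"
  shows "x \<preceq>\<^sub>Q y \<longleftrightarrow> x\<^sup>\<star> = (y \<leadsto> x) \<leadsto> y\<^sup>\<star>"
proof -
  have cap: "x \<Cap> y = ((y \<leadsto> x) \<leadsto> y\<^sup>\<star>)\<^sup>\<star>"
    using imp_contrapos[OF y x] by (simp add: be_cap_def)
  have "(y \<leadsto> x) \<leadsto> y\<^sup>\<star> \<in> carrier X"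
    using x y by (simp add: imp_closed)
  then show ?thesis
    unfolding be_leQ_def cap by (rule eq_neg_iff[OF x])
qed

lemma leQ_neg_iff_cup_eq:
  assumes x: "x \<in> carrier X" and y: "y \<in> carrier X"
  shows "y\<^sup>\<star> \<preceq>\<^sub>Q x\<^sup>\<star> \<longleftrightarrow> y \<Cup> x = y"
proof -
  have "y\<^sup>\<star> \<preceq>\<^sub>Q x\<^sup>\<star> \<longleftrightarrow> y\<^sup>\<star> = (y \<Cup> x)\<^sup>\<star>"
    by (simp only: be_leQ_def cap_eq_neg_cup involutive x y)
  also have "\<dots> \<longleftrightarrow> y = y \<Cup> x"
    using eq_neg_iff[OF neg_closed[OF y] cup_closed[OF y x]] by (simp only: involutive y)
  finally show ?thesis
    by (simp only: eq_commute)
qed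

end

context implicative_orthomodular_algebra
begin

lemma leQ_imp:
  assumes "x \<in> carrier X" "d \<in> carrier X"
  shows "x \<preceq>\<^sub>Q d \<leadsto> x"
  using cap_imp[OF assms] by (simp add: be_leQ_def)

lemma leQ_neg:
  assumes x: "x \<in> carrier X" and y: "y \<in> carrier X" and le: "x \<preceq>\<^sub>Q y"
  shows "y\<^sup>\<star> \<preceq>\<^sub>Q x\<^sup>\<star>"
proof -
  have "x\<^sup>\<star> = (y \<leadsto> x) \<leadsto> y\<^sup>\<star>"
    using le leQ_iff_neg_eq[OF x y] by blast
  then show ?thesis
    using leQ_imp[of "y\<^sup>\<star>" "y \<leadsto> x"] x y by (simp add: imp_closed)
qed

text \<open>This replaces the equation defining \<open>\<preceq>\<^sub>Q\<close>, in which \<open>x\<close> occurs on both sides, by mere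
  existence of a premise \<open>d\<close>; this is what makes the monotonicity laws below immediate.\<close>

lemma leQ_iff_eq_imp:
  assumes x: "x \<in> carrier X" and y: "y \<in> carrier X"
  shows "x \<preceq>\<^sub>Q y \<longleftrightarrow> (\<exists>d \<in> carrier X. y = d \<leadsto> x)"
proof
  assume "x \<preceq>\<^sub>Q y"
  then have "y\<^sup>\<star> \<preceq>\<^sub>Q x\<^sup>\<star>"
    by (rule leQ_neg[OF x y])
  then have "y = (x\<^sup>\<star> \<leadsto> y\<^sup>\<star>) \<leadsto> x"
    using leQ_iff_neg_eq[of "y\<^sup>\<star>" "x\<^sup>\<star>"] x y by (simp add: involutive)
  then show "\<exists>d \<in> carrier X. y = d \<leadsto> x"
    using x y by (blast intro: imp_closed)
next
  assume "\<exists>d \<in> carrier X. y = d \<leadsto> x"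
  then show "x \<preceq>\<^sub>Q y"
    using leQ_imp[OF x] by blast
qed

lemma imp_mono:
  assumes x: "x \<in> carrier X" and y: "y \<in> carrier X" and z: "z \<in> carrier X" and le: "x \<preceq>\<^sub>Q y"
  shows "z \<leadsto> x \<preceq>\<^sub>Q z \<leadsto> y"
proof -
  obtain d where d: "d \<in> carrier X" and "y = d \<leadsto> x"
    using le leQ_iff_eq_imp[OF x y] by blast
  then have "z \<leadsto> y = d \<leadsto> (z \<leadsto> x)"
    using x z by (simp add: imp_exchange)
  then show ?thesis
    using leQ_imp[of "z \<leadsto> x" d] d x z by (simp add: imp_closed)
qed

lemma imp_antimono:
  assumes x: "x \<in> carrier X" and y: "y \<in> carrier X" and z: "z \<in> carrier X" and le: "x \<preceq>\<^sub>Q y"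
  shows "y \<leadsto> z \<preceq>\<^sub>Q x \<leadsto> z"
  using imp_mono[OF _ _ _ leQ_neg[OF x y le], of "z\<^sup>\<star>"] x y z
  by (simp add: imp_contrapos)

lemma cup_mono:
  assumes x: "x \<in> carrier X" and y: "y \<in> carrier X" and z: "z \<in> carrier X" and le: "x \<preceq>\<^sub>Q y"
  shows "x \<Cup> z \<preceq>\<^sub>Q y \<Cup> z"
  unfolding be_cup_def
  by (intro imp_antimono imp_closed x y z le)

lemma cap_mono:
  assumes x: "x \<in> carrier X" and y: "y \<in> carrier X" and z: "z \<in> carrier X" and le: "x \<preceq>\<^sub>Q y"
  shows "x \<Cap> z \<preceq>\<^sub>Q y \<Cap> z"
  unfolding cap_eq_neg_cup
  by (intro leQ_neg cup_mono neg_closed cup_closed x y z le)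

lemma leQ_imp_cup_eq:
  assumes x: "x \<in> carrier X" and y: "y \<in> carrier X" and le: "x \<preceq>\<^sub>Q y"
  shows "y \<Cup> x = y"
  using leQ_neg[OF x y le] leQ_neg_iff_cup_eq[OF x y] by blast

lemma leQ_cup:
  assumes x: "x \<in> carrier X" and y: "y \<in> carrier X"
  shows "x \<preceq>\<^sub>Q y \<Cup> x"
  unfolding be_cup_def using x y by (intro leQ_imp imp_closed)

lemma cap_leQ:
  assumes x: "x \<in> carrier X" and y: "y \<in> carrier X"
  shows "y \<Cap> x \<preceq>\<^sub>Q x"
proof -
  have "(y\<^sup>\<star> \<Cup> x\<^sup>\<star>)\<^sup>\<star> \<preceq>\<^sub>Q (x\<^sup>\<star>)\<^sup>\<star>"
    using x y by (intro leQ_neg leQ_cup) auto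
  then show ?thesis
    using x by (simp only: cap_eq_neg_cup involutive)
qed

end

theorem proposition3p5:
  fixes X :: "('a, 'b) bounded_be_struct_scheme" (structure)
  assumes "implicative_orthomodular_algebra X"
    and "x \<in> carrier X" and "y \<in> carrier X" and "z \<in> carrier X"
  shows "(x \<Cap> (y \<Cup> x) = x \<and> x \<Cup> (y \<Cap> x) = x) \<and>
    (x \<preceq>\<^sub>Q y \<longrightarrow>
      (y \<Cup> x = y \<and> y\<^sup>\<star> \<preceq>\<^sub>Q x\<^sup>\<star>) \<and>
      (y \<leadsto> z \<preceq>\<^sub>Q x \<leadsto> z \<and> z \<leadsto> x \<preceq>\<^sub>Q z \<leadsto> y) \<and>
      (x \<Cap> z \<preceq>\<^sub>Q y \<Cap> z \<and> x \<Cup> z \<preceq>\<^sub>Q y \<Cup> z) \<and>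
      (z \<leadsto> y) \<Cup> (z \<leadsto> x) = z \<leadsto> y)"
proof -
  interpret implicative_orthomodular_algebra X by fact
  note xyz = assms(2-4)
  have "x \<Cap> (y \<Cup> x) = x"
    using leQ_cup[of x y] xyz by (simp add: be_leQ_def)
  moreover have "x \<Cup> (y \<Cap> x) = x"
    using xyz by (intro leQ_imp_cup_eq cap_leQ cap_closed)
  moreover have "(z \<leadsto> y) \<Cup> (z \<leadsto> x) = z \<leadsto> y" if "x \<preceq>\<^sub>Q y"
    using xyz that by (intro leQ_imp_cup_eq imp_mono imp_closed)
  ultimately show ?thesis
    using leQ_imp_cup_eq[OF xyz(1,2)] leQ_neg[OF xyz(1,2)] imp_antimono[OF xyz]
      imp_mono[OF xyz] cap_mono[OF xyz] cup_mono[OF xyz] by iprover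
qed

end
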